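(* Let $Z\in M_n(\mathbb{R})$ be a positive definite symmetric matrix with $Z_{ii}=1$ for all $i$. Let $v_1,\dots,v_n\in\mathbb{R}^n$ be linearly independent vectors such that $Z=V^tV$ with $V=(v_1\ \dots\ v_n)$. Then $$\mathrm{Mag}\,Z=4R^2,$$ where $R$ is the radius of the circumsphere of the points $\{0,v_1,\dots,v_n\}$.
   Context: $C^t$ denotes the transpose of $C$. For invertible symmetric $Z$, the magnitude is $\mathrm{Mag}\,Z=\sum_{i,j}(Z^{-1})_{ij}$. The circumsphere of the $n+1$ affinely independent points $0,v_1,\dots,v_n$ is the unique sphere in Euclidean $\mathbb{R}^n$ passing through all of them. *)

theory Defs
  imports "HOL-Analysis.Analysis"
begin

definition positive_definite :: "real ^ 'n ^ 'n \<Rightarrow> bool" where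
  "positive_definite Z \<longleftrightarrow> (\<forall>x. x \<noteq> 0 \<longrightarrow> x \<bullet> (Z *v x) > 0)"

(* Only meaningful for invertible Z: matrix_inv is unspecified otherwise. *)
definition Mag :: "real ^ 'n ^ 'n \<Rightarrow> real" where
  "Mag Z = (\<Sum>i\<in>UNIV. \<Sum>j\<in>UNIV. matrix_inv Z $ i $ j)"

definition matrix_of_columns :: "('n \<Rightarrow> real ^ 'm) \<Rightarrow> real ^ 'n ^ 'm" where
  "matrix_of_columns v = (\<chi> i j. v j $ i)"

(* Intended for P consisting of DIM('a) + 1 affinely independent points, where the sphere
   is unique; otherwise the description operator may be unspecified. *)
definition circumsphere :: "'a::euclidean_space set \<Rightarrow> 'a set" where
  "circumsphere P = (THE S. (\<exists>c r. r > 0 \<and> S = sphere c r) \<and> P \<subseteq> S)"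

definition circumradius :: "'a::euclidean_space set \<Rightarrow> real" where
  "circumradius P = (THE r. r > 0 \<and> (\<exists>c. circumsphere P = sphere c r))"

end

theory Submission
  imports Defs
begin

text \<open>
  A sphere through 0 has radius \<^term>\<open>norm c\<close>, where c is its centre, and it passes through
  a further point b exactly when \<open>b \<bullet> c = (b \<bullet> b) / 2\<close>. The columns
  \<open>v i\<close> of V are unit vectors because Z has unit diagonal, so the
  circumcentre is the solution of the linear system \<open>V\<^sup>t c = (1/2) \<one>\<close>, where \<open>\<one>\<close> is the all-ones vector; it is unique since the
  \<open>v i\<close> span the space (lemma \<open>circumradius_of_spanning_set\<close>).

  The magnitude is governed by a system with the same right-hand side up to the factor 2:
  it is the sum of the entries of the weighting w, the solution of \<open>Z w = \<one>\<close>
  (lemma \<open>Mag_eq_sum_weighting\<close>). As \<open>Z = V\<^sup>t V\<close>, the vector \<open>V w\<close> solves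
  \<open>V\<^sup>t (V w) = \<one>\<close>, so \<open>V w\<close> is twice the circumcentre. Finally
  \<open>\<one> \<bullet> w = Z w \<bullet> w = V w \<bullet> V w\<close>, which is the squared norm of twice the
  circumcentre, that is, \<open>4 R\<^sup>2\<close>.
\<close>

text \<open>
  Equality of the distances from c to 0 and to b is linear in c: expanding the squares, the
  term \<open>c \<bullet> c\<close> cancels.
\<close>

lemma origin_and_point_in_sphere_iff:
  fixes b c :: "'a::real_inner"
  shows "0 \<in> sphere c r \<and> b \<in> sphere c r \<longleftrightarrow> r = norm c \<and> b \<bullet> c = (b \<bullet> b) / 2"
proof -
  have "dist c b = norm c \<longleftrightarrow> (norm (c - b))\<^sup>2 = (norm c)\<^sup>2"
    by (simp add: dist_norm power2_eq_iff_nonneg)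
  also have "\<dots> \<longleftrightarrow> b \<bullet> c = (b \<bullet> b) / 2"
    by (auto simp: power2_norm_eq_inner algebra_simps inner_commute)
  finally show ?thesis by auto
qed

text \<open>
  The two descriptions in the definition of the circumradius are resolved at once: any sphere
  through the points, however it is presented, has its centre and radius determined by the
  linear equations above, since a vector orthogonal to a spanning set vanishes.
\<close>

lemma circumradius_of_spanning_set:
  fixes c :: "'a::euclidean_space"
  assumes span: "span B = UNIV" and "c \<noteq> 0"
    and centre: "\<And>b. b \<in> B \<Longrightarrow> b \<bullet> c = (b \<bullet> b) / 2"
  shows "circumradius (insert 0 B) = norm c"
proof -
  have contains: "insert 0 B \<subseteq> sphere c (norm c)"
    using origin_and_point_in_sphere_iff[of c "norm c"] centre by auto
  have unique: "c' = c \<and> r' = norm c" if "insert 0 B \<subseteq> sphere c' r'" for c' r'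
  proof -
    have r': "r' = norm c'"
      using that by simp
    have "b \<bullet> c' = b \<bullet> c" if "b \<in> B" for b
      using origin_and_point_in_sphere_iff[of c' r' b] that centre[OF that]
        \<open>insert 0 B \<subseteq> sphere c' r'\<close> by auto
    then have "orthogonal (c' - c) b" if "b \<in> B" for b
      using that by (metis orthogonal_def inner_commute inner_diff_right right_minus_eq)
    then have "orthogonal (c' - c) (c' - c)"
      using orthogonal_to_span[of "c' - c" B] span by blast
    then show ?thesis
      using r' by (simp add: orthogonal_self)
  qed
  have sphere: "circumsphere (insert 0 B) = sphere c (norm c)"
    unfolding circumsphere_def
  proof (rule the_equality)
    show "(\<exists>c' r. r > 0 \<and> sphere c (norm c) = sphere c' r) \<and> insert 0 B \<subseteq> sphere c (norm c)"
      using contains \<open>c \<noteq> 0\<close> by (metis zero_less_norm_iff)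
  next
    fix S assume "(\<exists>c' r. r > 0 \<and> S = sphere c' r) \<and> insert 0 B \<subseteq> S"
    then show "S = sphere c (norm c)"
      using unique by blast
  qed
  show ?thesis
    unfolding circumradius_def sphere
  proof (rule the_equality)
    show "norm c > 0 \<and> (\<exists>c'. sphere c (norm c) = sphere c' (norm c))"
      using \<open>c \<noteq> 0\<close> by auto
  next
    fix r assume "r > 0 \<and> (\<exists>c'. sphere c (norm c) = sphere c' r)"
    then show "r = norm c"
      using contains unique by blast
  qed
qed

lemma positive_definite_imp_invertible:
  assumes "positive_definite Z"
  shows "invertible Z"
proof -
  have "x = 0" if "Z *v x = 0" for x
    using assms that unfolding positive_definite_def by (metis inner_zero_right less_irrefl)
  then show ?thesis
    by (simp add: invertible_left_inverse matrix_left_invertible_ker)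
qed

lemma matrix_inv_inverse:
  assumes "invertible A"
  shows "A ** matrix_inv A = mat 1" and "matrix_inv A ** A = mat 1"
  using someI_ex[OF assms[unfolded invertible_def]] unfolding matrix_inv_def by blast+

lemma Mag_eq_sum_weighting:
  fixes Z :: "real ^ 'n ^ 'n"
  assumes "invertible Z" and "Z *v w = 1"
  shows "Mag Z = 1 \<bullet> w"
proof -
  have "matrix_inv Z *v 1 = w"
    by (simp add: matrix_vector_mul_assoc matrix_inv_inverse(2)[OF assms(1)] flip: assms(2))
  then have "w $ i = (\<Sum>j\<in>UNIV. matrix_inv Z $ i $ j)" for i
    by (auto simp: matrix_vector_mult_def)
  then show ?thesis
    by (simp add: Mag_def inner_vec_def)
qed

lemma transpose_matrix_of_columns_mult_nth:
  "(transpose (matrix_of_columns v) *v x) $ i = v i \<bullet> x"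
  by (simp add: matrix_of_columns_def transpose_def matrix_vector_mult_def inner_vec_def)

lemma gram_matrix_nth:
  "(transpose (matrix_of_columns v) ** matrix_of_columns v) $ i $ j = v i \<bullet> v j"
  by (simp add: matrix_of_columns_def transpose_def matrix_matrix_mult_def inner_vec_def)

theorem theorem1p3:
  fixes Z :: "real ^ 'n ^ 'n" and v :: "'n \<Rightarrow> real ^ 'n"
  assumes "transpose Z = Z" and "positive_definite Z"
    and "\<And>i. Z $ i $ i = 1"
    and "inj v" and "independent (range v)"
    and "Z = transpose (matrix_of_columns v) ** matrix_of_columns v"
  shows "Mag Z = 4 * (circumradius (insert 0 (range v)))\<^sup>2"
proof -
  let ?V = "matrix_of_columns v"
  have inv: "invertible Z"
    using assms(2) by (rule positive_definite_imp_invertible)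
  define w where "w = matrix_inv Z *v 1"
  have w: "Z *v w = 1"
    by (simp add: w_def matrix_vector_mul_assoc matrix_inv_inverse(1)[OF inv])
  then have Vw: "transpose ?V *v (?V *v w) = 1"
    using assms(6) by (simp add: matrix_vector_mul_assoc)
  \<comment> \<open>the circumcentre, in terms of the weighting w\<close>
  define c where "c = (1/2) *\<^sub>R (?V *v w)"
  have "v i \<bullet> (?V *v w) = 1" for i
    using transpose_matrix_of_columns_mult_nth[of v "?V *v w" i] Vw by simp
  then have half: "v i \<bullet> c = 1/2" for i
    by (simp add: c_def)
  have unit: "v i \<bullet> v i = 1" for i
    using assms(3)[of i] assms(6) gram_matrix_nth[of v i i] by simp
  have "card (range v) = dim (UNIV :: (real ^ 'n) set)"
    using \<open>inj v\<close> by (simp add: card_image)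
  then have "span (range v) = UNIV"
    using card_ge_dim_independent[of "range v" UNIV] assms(5) by auto
  then have R: "circumradius (insert 0 (range v)) = norm c"
    using half unit by (intro circumradius_of_spanning_set) auto
  have "Mag Z = (transpose ?V *v (?V *v w)) \<bullet> w"
    using Mag_eq_sum_weighting[OF inv w] Vw by simp
  also have "\<dots> = (?V *v w) \<bullet> (?V *v w)"
    by (simp add: dot_lmul_matrix)
  also have "\<dots> = 4 * (norm c)\<^sup>2"
    by (simp add: c_def power_divide power2_norm_eq_inner)
  finally show ?thesis
    using R by simp
qed

end
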